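(* Let $\mathcal{X}=\mathbb{R}^n$ and $\mathcal{F}_P=\mathbb{R}^m$, with dual spaces $\mathcal{X}^*$ and $\mathcal{E}_P=\mathcal{F}_P^*$ in dual coordinates. Let $\mathcal{M}\subset\mathcal{X}\times\mathcal{X}^*\times\mathcal{F}_P\times\mathcal{E}_P$ be a maximally monotone structure and let $\mathcal{L}=\operatorname{im}\begin{bmatrix}P\\ S\end{bmatrix}\subset\mathcal{X}\times\mathcal{X}^*$ be a Lagrange structure, where $P,S\in\mathbb{R}^{n\times n}$ satisfy $S^\top P=P^\top S$ and $\operatorname{rank}\begin{bmatrix}P\\ S\end{bmatrix}=n$. Then there exist an integer $k\ge0$ and real matrices $J,R\in\mathbb{R}^{n\times n}$, $N,W\in\mathbb{R}^{m\times m}$, $B,V\in\mathbb{R}^{n\times m}$, $G\in\mathbb{R}^{n\times k}$, $G_P\in\mathbb{R}^{m\times k}$ with $J,N$ skew-symmetric and $\begin{bmatrix}R&V\\ V^\top&W\end{bmatrix}$ symmetric positive semidefinite, such that the dynamics of the port-Hamiltonian DAE system $(\mathcal{M},\mathcal{L})$, parametrized by $x=Pz$, $e=Sz$, is given by $$\begin{aligned}P\dot z&=(J-R)Sz+G\lambda+(B-V)e_P,\\ 0&=G^\top Sz+G_P^\top e_P,\\ f_P&=(B+V)^\top Sz+(N+W)e_P-G_P\lambda.\end{aligned}$$ That is, for every differentiable function $t\mapsto z(t)\in\mathbb{R}^n$ and all functions $f_P(t)\in\mathcal{F}_P$, $e_P(t)\in\mathcal{E}_P$ on an interval, one has $(-P\dot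 z(t),Sz(t),f_P(t),e_P(t))\in\mathcal{M}$ for all $t$ if and only if there exists a function $\lambda(t)\in\mathbb{R}^k$ such that the three equations above hold for all $t$.
   Context: On $\mathcal{F}\times\mathcal{F}^*$, with $\mathcal{F}$ a finite-dimensional real vector space and $\langle e\mid f\rangle$ the duality pairing, a linear subspace $\mathcal{M}$ is a monotone structure if $\langle e\mid f\rangle\ge0$ for all $(f,e)\in\mathcal{M}$, and a maximally monotone structure if it is maximal (with respect to inclusion among subspaces) with this property. The space $\mathcal{X}\times\mathcal{X}^*\times\mathcal{F}_P\times\mathcal{E}_P$ is identified with $(\mathcal{X}\times\mathcal{F}_P)\times(\mathcal{X}\times\mathcal{F}_P)^*$, with pairing $\langle e\mid f\rangle+\langle e_P\mid f_P\rangle$ for the element $(f,e,f_P,e_P)$. A Lagrange structure $\mathcal{L}\subset\mathcal{X}\times\mathcal{X}^*$ is a linear subspace on which the form $\langle (f_1,e_1),(f_2,e_2)\rangle_-=\langle e_1\mid f_2\rangle-\langle e_2\mid f_1\rangle$ vanishes and which is maximal with this property; every Lagrange structure has the form $\operatorname{im}\begin{bmatrix}P\\ S\end{bmatrix}$ with $P,S$ as in the claim. The port-Hamiltonian DAE system $(\mathcal{M},\mathcal{L})$ is the set of all $(\dot x,x,f_P,e_P)$ for which there exists $e\in\mathcal{X}^*$ such that $(-\dot x,e,f_P,e_P)\in\mathcal{M}$ and $(x,e)\in\mathcal{L}$. *)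

theory Defs
  imports Complex_Main "Jordan_Normal_Form.DL_Rank"
begin

text \<open>
  Vectors of \<open>\<real>\<^sup>N\<close> are the elements of \<open>carrier_vec N\<close>; the dual space is also \<open>carrier_vec N\<close>
  (dual coordinates), so the duality pairing is the scalar product.
  All dimensions may be \<open>0\<close>.
\<close>

abbreviation phase_space :: "nat \<Rightarrow> (real, real vec \<times> real vec) module" where
  "phase_space N \<equiv> direct_sum (module_vec TYPE(real) N) (module_vec TYPE(real) N)"

definition monotone_structure :: "nat \<Rightarrow> (real vec \<times> real vec) set \<Rightarrow> bool" where
  "monotone_structure N M \<longleftrightarrow>
     VectorSpace.subspace class_ring M (phase_space N) \<and> (\<forall>(f, e) \<in> M. e \<bullet> f \<ge> 0)"

definition maximally_monotone_structure :: "nat \<Rightarrow> (real vec \<times> real vec) set \<Rightarrow> bool" where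
  "maximally_monotone_structure N M \<longleftrightarrow>
     monotone_structure N M \<and> (\<forall>M'. monotone_structure N M' \<and> M \<subseteq> M' \<longrightarrow> M' = M)"

definition isotropic_structure :: "nat \<Rightarrow> (real vec \<times> real vec) set \<Rightarrow> bool" where
  "isotropic_structure n L \<longleftrightarrow>
     VectorSpace.subspace class_ring L (phase_space n) \<and>
     (\<forall>(f1, e1) \<in> L. \<forall>(f2, e2) \<in> L. e1 \<bullet> f2 - e2 \<bullet> f1 = 0)"

definition lagrange_structure :: "nat \<Rightarrow> (real vec \<times> real vec) set \<Rightarrow> bool" where
  "lagrange_structure n L \<longleftrightarrow>
     isotropic_structure n L \<and> (\<forall>L'. isotropic_structure n L' \<and> L \<subseteq> L' \<longrightarrow> L' = L)"

text \<open>
  The identification of \<open>\<X> \<times> \<X>\<^sup>* \<times> \<F>\<^sub>P \<times> \<E>\<^sub>P\<close> with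
  \<open>(\<X> \<times> \<F>\<^sub>P) \<times> (\<X> \<times> \<F>\<^sub>P)\<^sup>*\<close>. It is injective only for
  components of known dimension, so membership in the carriers is required separately below.
\<close>

definition port_identification ::
  "real vec \<times> real vec \<times> real vec \<times> real vec \<Rightarrow> real vec \<times> real vec" where
  "port_identification = (\<lambda>(f, e, fP, eP). (f @\<^sub>v fP, e @\<^sub>v eP))"

definition maximally_monotone_port_structure ::
  "nat \<Rightarrow> nat \<Rightarrow> (real vec \<times> real vec \<times> real vec \<times> real vec) set \<Rightarrow> bool" where
  "maximally_monotone_port_structure n m M \<longleftrightarrow>
     M \<subseteq> carrier_vec n \<times> carrier_vec n \<times> carrier_vec m \<times> carrier_vec m \<and>
     maximally_monotone_structure (n + m) (port_identification ` M)"

definition pH_DAE_system ::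
  "(real vec \<times> real vec \<times> real vec \<times> real vec) set \<Rightarrow> (real vec \<times> real vec) set \<Rightarrow>
   (real vec \<times> real vec \<times> real vec \<times> real vec) set" where
  "pH_DAE_system M L = {(xdot, x, fP, eP). \<exists>e. (- xdot, e, fP, eP) \<in> M \<and> (x, e) \<in> L}"

definition stacked_image :: "real mat \<Rightarrow> real mat \<Rightarrow> (real vec \<times> real vec) set" where
  "stacked_image P S = {(P *\<^sub>v z, S *\<^sub>v z) | z. z \<in> carrier_vec (dim_col P)}"

definition skew_symmetric_mat :: "real mat \<Rightarrow> bool" where
  "skew_symmetric_mat A \<longleftrightarrow> square_mat A \<and> transpose_mat A = - A"

definition pos_semidef_mat :: "real mat \<Rightarrow> bool" where
  "pos_semidef_mat A \<longleftrightarrow> square_mat A \<and> transpose_mat A = A \<and>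
     (\<forall>v \<in> carrier_vec (dim_row A). v \<bullet> (A *\<^sub>v v) \<ge> 0)"

definition pH_DAE_equations ::
  "real mat \<Rightarrow> real mat \<Rightarrow> real mat \<Rightarrow> real mat \<Rightarrow> real mat \<Rightarrow> real mat \<Rightarrow> real mat \<Rightarrow> real mat \<Rightarrow>
   real mat \<Rightarrow> real mat \<Rightarrow> real vec \<Rightarrow> real vec \<Rightarrow> real vec \<Rightarrow> real vec \<Rightarrow> real vec \<Rightarrow> bool" where
  "pH_DAE_equations P S J R N W B V G GP zdot z fP eP l \<longleftrightarrow>
     P *\<^sub>v zdot = (J - R) *\<^sub>v (S *\<^sub>v z) + G *\<^sub>v l + (B - V) *\<^sub>v eP \<and>
     0\<^sub>v (dim_col G) = transpose_mat G *\<^sub>v (S *\<^sub>v z) + transpose_mat GP *\<^sub>v eP \<and>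
     fP = transpose_mat (B + V) *\<^sub>v (S *\<^sub>v z) + (N + W) *\<^sub>v eP - GP *\<^sub>v l"

definition nondegenerate_interval :: "real set \<Rightarrow> bool" where
  "nondegenerate_interval I \<longleftrightarrow>
     (\<forall>a \<in> I. \<forall>b \<in> I. {a..b} \<subseteq> I) \<and> (\<exists>a \<in> I. \<exists>b \<in> I. a < b)"

text \<open>
  There is no topology on \<open>real vec\<close>, so derivatives are taken componentwise; at an end point
  belonging to \<open>I\<close> they are one-sided.
\<close>

definition has_vec_derivative_on ::
  "nat \<Rightarrow> (real \<Rightarrow> real vec) \<Rightarrow> (real \<Rightarrow> real vec) \<Rightarrow> real set \<Rightarrow> bool" where
  "has_vec_derivative_on n z zdot I \<longleftrightarrow>
     (\<forall>t \<in> I. z t \<in> carrier_vec n \<and> zdot t \<in> carrier_vec n \<and>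
       (\<forall>i < n. ((\<lambda>s. z s $ i) has_real_derivative zdot t $ i) (at t within I)))"

end

theory Submission
  imports Defs
begin

text \<open>
  Let \<open>D\<close> be a maximally monotone subspace of \<open>\<real>\<^sup>N \<times> \<real>\<^sup>N\<close> and \<open>E\<close> its projection to the second
  component. Monotonicity and maximality give \<open>(g, 0) \<in> D\<close> iff \<open>g\<close> is orthogonal to \<open>E\<close>. Take an
  orthonormal basis of \<open>E\<close>, as the columns of \<open>U\<close>, and \<open>F\<close> such that \<open>(F v, U v) \<in> D\<close> for all \<open>v\<close>.
  With \<open>H = 1 - U U\<^sup>T\<close>, the projection to the complement of \<open>E\<close>, one gets
  \<open>D = {(A e - H l, e). H\<^sup>T e = 0}\<close>; here \<open>A\<close> may be changed by anything with values in the complement of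
  \<open>E\<close>, and the choice \<open>A = U U\<^sup>T F U\<^sup>T\<close> makes its quadratic form nonnegative on the whole space.
  The matrices of the theorem are the blocks of \<open>H\<close> and of the symmetric and skew parts of \<open>A\<close>.
\<close>

section \<open>Linear subspaces of pairs and orthonormal frames\<close>

text \<open>All later arguments use only closure under sums and scaling, so the abstract notion is
  replaced by these conditions once and for all.\<close>

lemma subspace_phase_space_iff:
  "VectorSpace.subspace class_ring D (phase_space N) \<longleftrightarrow>
    D \<subseteq> carrier_vec N \<times> carrier_vec N \<and> (0\<^sub>v N, 0\<^sub>v N) \<in> D \<and>
    (\<forall>f e f' e'. (f, e) \<in> D \<longrightarrow> (f', e') \<in> D \<longrightarrow> (f + f', e + e') \<in> D) \<and>
    (\<forall>c f e. (f, e) \<in> D \<longrightarrow> (c \<cdot>\<^sub>v f, c \<cdot>\<^sub>v e) \<in> D)" (is "_ \<longleftrightarrow> ?R")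
proof -
  have vs: "vectorspace class_ring (phase_space N)"
    by (rule direct_sum_is_vs) (rule vec_vs)+
  then have "module class_ring (phase_space N)"
    by (simp add: vectorspace_def)
  then have "submodule class_ring D (phase_space N) \<longleftrightarrow> ?R"
    unfolding submodule_def
    by (auto simp: direct_sum_def module_vec_simps)
  then show ?thesis
    using vs by (simp add: VectorSpace.subspace_def)
qed

lemma orthonormal_cols_le:
  fixes U :: "real mat"
  assumes U: "U \<in> carrier_mat N r" and orth: "transpose_mat U * U = 1\<^sub>m r"
  shows "r \<le> N"
  \<comment> \<open>Padding \<open>U\<close> with zero rows gives a square matrix with a left inverse but a zero row.\<close>
proof (rule ccontr)
  assume "\<not> r \<le> N"
  then have less: "N < r" by simp
  define X where "X = mat r r (\<lambda>(i, j). if i < N then U $$ (i, j) else 0)"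
  have X: "X \<in> carrier_mat r r" by (simp add: X_def)
  have "transpose_mat X * X = transpose_mat U * U"
  proof (rule eq_matI)
    fix i j
    assume "i < dim_row (transpose_mat U * U)" "j < dim_col (transpose_mat U * U)"
    then have ij: "i < r" "j < r" using U by auto
    have "(\<Sum>l = 0..<r. X $$ (l, i) * X $$ (l, j)) = (\<Sum>l = 0..<N. U $$ (l, i) * U $$ (l, j))"
      using less ij by (intro sum.mono_neutral_cong_right) (auto simp: X_def)
    then show "(transpose_mat X * X) $$ (i, j) = (transpose_mat U * U) $$ (i, j)"
      using ij U X by (simp add: scalar_prod_def)
  qed (use U X in auto)
  then have "X * transpose_mat X = 1\<^sub>m r"
    using orth X by (intro mat_mult_left_right_inverse[of "transpose_mat X"]) auto
  then have "(X * transpose_mat X) $$ (N, N) = 1"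
    using less by simp
  moreover have "(X * transpose_mat X) $$ (N, N) = 0"
    using less X by (simp add: scalar_prod_def X_def)
  ultimately show False by simp
qed

text \<open>Serves to lengthen both a frame \<open>U\<close> and its lift \<open>F\<close> by one
  vector, in the argument that a longest frame spans.\<close>

definition snoc_col :: "'a mat \<Rightarrow> 'a vec \<Rightarrow> 'a mat" where
  "snoc_col U u = mat (dim_row U) (Suc (dim_col U)) (\<lambda>(i, j). if j < dim_col U then U $$ (i, j) else u $ i)"

lemma snoc_col_carrier: "U \<in> carrier_mat N r \<Longrightarrow> snoc_col U u \<in> carrier_mat N (Suc r)"
  by (simp add: snoc_col_def)

lemma snoc_col_mult_vec:
  fixes U :: "real mat"
  assumes "U \<in> carrier_mat N r" "u \<in> carrier_vec N" "v \<in> carrier_vec (Suc r)"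
  shows "snoc_col U u *\<^sub>v v = U *\<^sub>v vec r (($) v) + v $ r \<cdot>\<^sub>v u"
  using assms by (intro eq_vecI) (auto simp: snoc_col_def scalar_prod_def)

text \<open>The entries of the product are the scalar products of the columns: old with old is
  \<open>orth\<close>, old with new is \<open>perp\<close>, new with new is
  \<open>unit\<close>.\<close>

lemma transpose_snoc_col_mult:
  fixes U :: "real mat"
  assumes U: "U \<in> carrier_mat N r" and u: "u \<in> carrier_vec N"
    and orth: "transpose_mat U * U = 1\<^sub>m r" and unit: "u \<bullet> u = 1" and perp: "transpose_mat U *\<^sub>v u = 0\<^sub>v r"
  shows "transpose_mat (snoc_col U u) * snoc_col U u = 1\<^sub>m (Suc r)"
proof -
  have [simp]: "snoc_col U u \<in> carrier_mat N (Suc r)" using U by (rule snoc_col_carrier)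
  have col: "col (snoc_col U u) j = (if j < r then col U j else u)" if "j < Suc r" for j
    using that U u by (intro eq_vecI) (auto simp: snoc_col_def)
  have UU: "col U i \<bullet> col U j = (if i = j then 1 else 0)" if "i < r" "j < r" for i j
    using arg_cong[OF orth, of "\<lambda>A. A $$ (i, j)"] that U by simp
  have Uu: "col U i \<bullet> u = 0" if "i < r" for i
    using arg_cong[OF perp, of "\<lambda>w. w $ i"] that U by simp
  then have uU: "u \<bullet> col U i = 0" if "i < r" for i
    using that u U by (metis comm_scalar_prod col_carrier_vec)
  show ?thesis
    using U u
    by (intro eq_matI) (auto simp: snoc_col_carrier[OF U, THEN carrier_matD(1)]
      snoc_col_carrier[OF U, THEN carrier_matD(2)] col UU Uu uU unit)
qed

lemma scalar_prod_self_pos: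
  fixes e :: "real vec"
  assumes "e \<in> carrier_vec N" "e \<noteq> 0\<^sub>v N"
  shows "e \<bullet> e > 0"
proof -
  obtain i where i: "i < N" "e $ i \<noteq> 0"
    using assms by (metis carrier_vecD eq_vecI index_zero_vec)
  have "0 < (\<Sum>j = 0..<N. e $ j * e $ j)"
    using i by (intro sum_pos2[of _ i]) (auto simp: zero_less_mult_iff)
  then show ?thesis using assms(1) by (simp add: scalar_prod_def)
qed

text \<open>The number of columns of an orthonormal frame is at most \<open>N\<close>, so a longest
  one exists. A pair in \<open>D\<close> whose second component is nonzero and orthogonal to all
  columns of \<open>U\<close> could be normalised and appended, giving a longer frame. The matrix
  \<open>F\<close> carries along first components, so that every combination of the columns of
  \<open>U\<close> comes with a linearly chosen partner in \<open>D\<close>.\<close>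

lemma orthonormal_frame_exists:
  fixes D :: "(real vec \<times> real vec) set"
  assumes D: "VectorSpace.subspace class_ring D (phase_space N)"
  obtains r U F where "U \<in> carrier_mat N r" "F \<in> carrier_mat N r" "transpose_mat U * U = 1\<^sub>m r"
    "\<And>v. v \<in> carrier_vec r \<Longrightarrow> (F *\<^sub>v v, U *\<^sub>v v) \<in> D"
    "\<And>f e. (f, e) \<in> D \<Longrightarrow> transpose_mat U *\<^sub>v e = 0\<^sub>v r \<Longrightarrow> e = 0\<^sub>v N"
proof -
  note sub = D[unfolded subspace_phase_space_iff]
  define frame where "frame r U F \<longleftrightarrow> U \<in> carrier_mat N r \<and> F \<in> carrier_mat N r \<and>
    transpose_mat U * U = 1\<^sub>m r \<and> (\<forall>v \<in> carrier_vec r. (F *\<^sub>v v, U *\<^sub>v v) \<in> D)" for r U F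
  have "frame 0 (0\<^sub>m N 0) (0\<^sub>m N 0)"
  proof -
    have "0\<^sub>m N 0 *\<^sub>v v = 0\<^sub>v N" if "v \<in> carrier_vec 0" for v :: "real vec"
      using that by (intro eq_vecI) (auto simp: scalar_prod_def)
    then show ?thesis using sub by (auto simp: frame_def)
  qed
  then have "\<exists>U F. frame 0 U F" by blast
  moreover have "r \<le> N" if "\<exists>U F. frame r U F" for r
    using that orthonormal_cols_le by (auto simp: frame_def)
  ultimately obtain r where r: "\<exists>U F. frame r U F" and max: "\<And>r'. \<exists>U F. frame r' U F \<Longrightarrow> r' \<le> r"
    using ex_has_greatest_nat[of "\<lambda>r. \<exists>U F. frame r U F" 0 "\<lambda>r. r" "Suc N"]
    by (auto simp: less_Suc_eq_le)
  from r obtain U F where UF: "U \<in> carrier_mat N r" "F \<in> carrier_mat N r" "transpose_mat U * U = 1\<^sub>m r"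
    "\<And>v. v \<in> carrier_vec r \<Longrightarrow> (F *\<^sub>v v, U *\<^sub>v v) \<in> D"
    by (auto simp: frame_def)
  have "e = 0\<^sub>v N" if fe: "(f, e) \<in> D" and perp: "transpose_mat U *\<^sub>v e = 0\<^sub>v r" for f e
  proof (rule ccontr)
    assume "e \<noteq> 0\<^sub>v N"
    have f: "f \<in> carrier_vec N" and e: "e \<in> carrier_vec N" using fe sub by auto
    have pos: "e \<bullet> e > 0" using scalar_prod_self_pos[OF e \<open>e \<noteq> 0\<^sub>v N\<close>] .
    define c where "c = 1 / sqrt (e \<bullet> e)"
    have cfe: "(c \<cdot>\<^sub>v f, c \<cdot>\<^sub>v e) \<in> D" using fe sub by blast
    have "(c \<cdot>\<^sub>v e) \<bullet> (c \<cdot>\<^sub>v e) = c * c * (e \<bullet> e)" using e by simp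
    also have "\<dots> = 1" using pos by (simp add: c_def)
    finally have unit: "(c \<cdot>\<^sub>v e) \<bullet> (c \<cdot>\<^sub>v e) = 1" .
    have perp': "transpose_mat U *\<^sub>v (c \<cdot>\<^sub>v e) = 0\<^sub>v r"
      using perp UF(1) e by (subst mult_mat_vec[of _ r N]) auto
    \<comment> \<open>Scaling \<open>f\<close> by the same factor as \<open>e\<close> keeps the new
      pair of columns in \<open>D\<close>.\<close>
    have "frame (Suc r) (snoc_col U (c \<cdot>\<^sub>v e)) (snoc_col F (c \<cdot>\<^sub>v f))"
      unfolding frame_def
    proof (intro conjI ballI)
      show "transpose_mat (snoc_col U (c \<cdot>\<^sub>v e)) * snoc_col U (c \<cdot>\<^sub>v e) = 1\<^sub>m (Suc r)"
        using UF(1,3) e unit perp' by (intro transpose_snoc_col_mult) auto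
      fix v :: "real vec" assume v: "v \<in> carrier_vec (Suc r)"
      \<comment> \<open>The first \<open>r\<close> entries of \<open>v\<close> act on the old
        columns and the last entry on the new one.\<close>
      have "(F *\<^sub>v vec r (($) v) + v $ r \<cdot>\<^sub>v (c \<cdot>\<^sub>v f), U *\<^sub>v vec r (($) v) + v $ r \<cdot>\<^sub>v (c \<cdot>\<^sub>v e)) \<in> D"
        using UF(4)[of "vec r (($) v)"] cfe sub by auto
      then show "(snoc_col F (c \<cdot>\<^sub>v f) *\<^sub>v v, snoc_col U (c \<cdot>\<^sub>v e) *\<^sub>v v) \<in> D"
        using UF f e v by (simp add: snoc_col_mult_vec)
    qed (use UF in \<open>auto intro: snoc_col_carrier\<close>)
    then show False using max[of "Suc r"] by auto
  qed
  then show thesis using that UF by blast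
qed


section \<open>Maximally monotone structures in terms of two matrices\<close>

text \<open>Adding multiples of \<open>(g, 0)\<close> to the elements of \<open>D\<close> does not
  change the pairing, because \<open>e \<bullet> g = 0\<close>. The enlarged subspace is therefore
  monotone, and maximality forces it to be \<open>D\<close> itself.\<close>

lemma mem_of_orthogonal_maximally_monotone:
  assumes D: "maximally_monotone_structure N D"
    and g: "g \<in> carrier_vec N" and perp: "\<And>f e. (f, e) \<in> D \<Longrightarrow> e \<bullet> g = 0"
  shows "(g, 0\<^sub>v N) \<in> D"
proof -
  have mono: "\<And>f e. (f, e) \<in> D \<Longrightarrow> 0 \<le> e \<bullet> f"
    and "VectorSpace.subspace class_ring D (phase_space N)"
    using D by (auto simp: maximally_monotone_structure_def monotone_structure_def)
  note sub = this(2)[unfolded subspace_phase_space_iff]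
  have zero: "(0\<^sub>v N, 0\<^sub>v N) \<in> D" using sub by blast
  define D' where "D' = {(f + c \<cdot>\<^sub>v g, e) | f e c. (f, e) \<in> D}"
  have D'I: "(f, e) \<in> D \<Longrightarrow> f' = f + c \<cdot>\<^sub>v g \<Longrightarrow> (f', e) \<in> D'" for f f' e c
    by (auto simp: D'_def)
  have carrier: "f \<in> carrier_vec N" "e \<in> carrier_vec N" if "(f, e) \<in> D" for f e
    using sub that by auto
  have "VectorSpace.subspace class_ring D' (phase_space N)"
    unfolding subspace_phase_space_iff
  proof (intro conjI allI impI)
    show "D' \<subseteq> carrier_vec N \<times> carrier_vec N"
      using sub g by (auto simp: D'_def)
    show "(0\<^sub>v N, 0\<^sub>v N) \<in> D'"
      using zero g by (intro D'I[of "0\<^sub>v N" _ _ 0]) auto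
  next
    fix f e f' e' assume "(f, e) \<in> D'" "(f', e') \<in> D'"
    then obtain f0 c f0' c' where
      *: "(f0, e) \<in> D" "f = f0 + c \<cdot>\<^sub>v g" "(f0', e') \<in> D" "f' = f0' + c' \<cdot>\<^sub>v g"
      by (auto simp: D'_def)
    have "f + f' = (f0 + f0') + (c + c') \<cdot>\<^sub>v g"
      using *(2,4) carrier[OF *(1)] carrier[OF *(3)] g by (intro eq_vecI) (auto simp: algebra_simps)
    moreover have "(f0 + f0', e + e') \<in> D" using * sub by blast
    ultimately show "(f + f', e + e') \<in> D'" by (rule D'I[rotated])
  next
    fix a f e assume "(f, e) \<in> D'"
    then obtain f0 c where *: "(f0, e) \<in> D" "f = f0 + c \<cdot>\<^sub>v g"
      by (auto simp: D'_def)
    have "a \<cdot>\<^sub>v f = a \<cdot>\<^sub>v f0 + (a * c) \<cdot>\<^sub>v g"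
      using *(2) carrier[OF *(1)] g by (intro eq_vecI) (auto simp: algebra_simps)
    moreover have "(a \<cdot>\<^sub>v f0, a \<cdot>\<^sub>v e) \<in> D" using * sub by blast
    ultimately show "(a \<cdot>\<^sub>v f, a \<cdot>\<^sub>v e) \<in> D'" by (rule D'I[rotated])
  qed
  moreover have "0 \<le> e \<bullet> f" if fe: "(f, e) \<in> D'" for f e
  proof -
    obtain f0 c where *: "(f0, e) \<in> D" "f = f0 + c \<cdot>\<^sub>v g"
      using fe by (auto simp: D'_def)
    then have "e \<bullet> f = e \<bullet> f0 + c * (e \<bullet> g)"
      using carrier[OF *(1)] g by (simp add: scalar_prod_add_distrib[of _ N])
    then show ?thesis using * perp mono by simp
  qed
  ultimately have "monotone_structure N D'"
    by (auto simp: monotone_structure_def)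
  moreover have "D \<subseteq> D'"
  proof
    fix p assume "p \<in> D"
    then show "p \<in> D'"
      using g carrier by (cases p) (auto intro!: D'I[of _ _ _ 0])
  qed
  ultimately have "D' = D" using D by (auto simp: maximally_monotone_structure_def)
  moreover have "(g, 0\<^sub>v N) \<in> D'"
    using zero g by (intro D'I[of "0\<^sub>v N" _ _ 1]) auto
  ultimately show ?thesis by simp
qed

text \<open>The kernel condition on \<open>H\<close> describes the possible second components
  \<open>e\<close>, and the first components that belong to one \<open>e\<close> form a coset of the
  range of \<open>H\<close>. The condition is written with the transpose of \<open>H\<close>,
  although the \<open>H\<close> constructed here is symmetric, because its blocks then become the
  transposes of \<open>G\<close> and \<open>GP\<close> in the algebraic equation.\<close>

lemma maximally_monotone_structure_representation:
  assumes D: "maximally_monotone_structure N D"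
  obtains A H where "A \<in> carrier_mat N N" "H \<in> carrier_mat N N"
    "\<And>v. v \<in> carrier_vec N \<Longrightarrow> 0 \<le> v \<bullet> (A *\<^sub>v v)"
    "\<And>f e. (f, e) \<in> D \<longleftrightarrow> e \<in> carrier_vec N \<and> transpose_mat H *\<^sub>v e = 0\<^sub>v N \<and>
      (\<exists>l \<in> carrier_vec N. f = A *\<^sub>v e - H *\<^sub>v l)"
proof -
  have mono: "\<And>f e. (f, e) \<in> D \<Longrightarrow> 0 \<le> e \<bullet> f"
    and subspace: "VectorSpace.subspace class_ring D (phase_space N)"
    using D by (auto simp: maximally_monotone_structure_def monotone_structure_def)
  note sub = subspace[unfolded subspace_phase_space_iff]
  have carrier: "f \<in> carrier_vec N" "e \<in> carrier_vec N" if "(f, e) \<in> D" for f e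
    using sub that by auto
  have diff: "(f - f', e - e') \<in> D" if "(f, e) \<in> D" "(f', e') \<in> D" for f e f' e'
  proof -
    have "(f + (-1) \<cdot>\<^sub>v f', e + (-1) \<cdot>\<^sub>v e') \<in> D" using sub that by blast
    moreover have "f + (-1) \<cdot>\<^sub>v f' = f - f'" "e + (-1) \<cdot>\<^sub>v e' = e - e'"
      using that by (auto intro!: eq_vecI dest!: carrier)
    ultimately show ?thesis by simp
  qed
  obtain r U F where U: "U \<in> carrier_mat N r" and F: "F \<in> carrier_mat N r"
    and orth: "transpose_mat U * U = 1\<^sub>m r"
    and FU: "\<And>v. v \<in> carrier_vec r \<Longrightarrow> (F *\<^sub>v v, U *\<^sub>v v) \<in> D"
    and spanning: "\<And>f e. (f, e) \<in> D \<Longrightarrow> transpose_mat U *\<^sub>v e = 0\<^sub>v r \<Longrightarrow> e = 0\<^sub>v N"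
    using orthonormal_frame_exists[OF subspace] by metis
  have Ut: "transpose_mat U \<in> carrier_mat r N" using U by simp
  have UtU: "transpose_mat U *\<^sub>v (U *\<^sub>v w) = w" if "w \<in> carrier_vec r" for w
    using assoc_mult_mat_vec[OF Ut U that] orth that by simp
  define H where "H = 1\<^sub>m N - U * transpose_mat U"
  define A where "A = U * (transpose_mat U * (F * transpose_mat U))"
  have H: "H \<in> carrier_mat N N" and A: "A \<in> carrier_mat N N"
    using U F by (auto simp: H_def A_def)
  have Hv: "H *\<^sub>v v = v - U *\<^sub>v (transpose_mat U *\<^sub>v v)" if "v \<in> carrier_vec N" for v
    using that U by (simp add: H_def minus_mult_distrib_mat_vec[of _ N N])
  have Av: "A *\<^sub>v v = U *\<^sub>v (transpose_mat U *\<^sub>v (F *\<^sub>v (transpose_mat U *\<^sub>v v)))"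
    if "v \<in> carrier_vec N" for v
    using that U F by (simp add: A_def assoc_mult_mat_vec[of _ N r _ N] assoc_mult_mat_vec[of _ r N _ N])
  have HtH: "transpose_mat H = H"
    using U by (simp add: H_def transpose_minus[of _ N N] transpose_mult[of _ N r _ N])
  have UtH: "transpose_mat U *\<^sub>v (H *\<^sub>v v) = 0\<^sub>v r" if "v \<in> carrier_vec N" for v
    using that U UtU[of "transpose_mat U *\<^sub>v v"]
    by (simp add: Hv mult_minus_distrib_mat_vec[of _ r N])
  have range: "e = U *\<^sub>v (transpose_mat U *\<^sub>v e)" if "(f, e) \<in> D" for f e
  proof -
    have e: "e \<in> carrier_vec N" using that carrier by blast
    \<comment> \<open>Subtracting the pair that lifts the projection of \<open>e\<close> leaves
      second component \<open>H e\<close>, which is orthogonal to all columns of \<open>U\<close>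
      and hence zero.\<close>
    have "(f - F *\<^sub>v (transpose_mat U *\<^sub>v e), H *\<^sub>v e) \<in> D"
      using diff[OF that FU[of "transpose_mat U *\<^sub>v e"]] e Ut by (simp add: Hv)
    then have "H *\<^sub>v e = 0\<^sub>v N" using spanning UtH e by blast
    then have "(e - U *\<^sub>v (transpose_mat U *\<^sub>v e)) $ i = 0" if "i < N" for i
      using that e by (simp add: Hv)
    then show ?thesis using e U by (intro eq_vecI) auto
  qed
  have perp: "(g, 0\<^sub>v N) \<in> D \<longleftrightarrow> transpose_mat U *\<^sub>v g = 0\<^sub>v r" if g: "g \<in> carrier_vec N" for g
  proof
    assume g0: "(g, 0\<^sub>v N) \<in> D"
    \<comment> \<open>\<open>(f + t g, e) \<in> D\<close> for all real \<open>t\<close>, so \<open>e \<bullet> f + t (e \<bullet> g)\<close> is bounded below.\<close>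
    have orthg: "e \<bullet> g = 0" if fe: "(f, e) \<in> D" for f e
    proof (rule ccontr)
      assume ne: "e \<bullet> g \<noteq> 0"
      define t where "t = - (e \<bullet> f + 1) / (e \<bullet> g)"
      have "(t \<cdot>\<^sub>v g, t \<cdot>\<^sub>v 0\<^sub>v N) \<in> D" using g0 sub by blast
      then have "(f + t \<cdot>\<^sub>v g, e + t \<cdot>\<^sub>v 0\<^sub>v N) \<in> D" using fe sub by blast
      moreover have "e + t \<cdot>\<^sub>v 0\<^sub>v N = e"
        using carrier[OF fe] by (intro eq_vecI) auto
      ultimately have "(f + t \<cdot>\<^sub>v g, e) \<in> D" by simp
      then have "0 \<le> e \<bullet> (f + t \<cdot>\<^sub>v g)" by (rule mono)
      also have "\<dots> = e \<bullet> f + t * (e \<bullet> g)"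
        using carrier[OF fe] g by (simp add: scalar_prod_add_distrib[of _ N])
      also have "\<dots> = -1" using ne by (simp add: t_def)
      finally show False by simp
    qed
    define w where "w = transpose_mat U *\<^sub>v g"
    have w: "w \<in> carrier_vec r" using Ut g by (auto simp: w_def)
    \<comment> \<open>\<open>U w\<close> is the second component of the pair
      \<open>(F w, U w)\<close> of \<open>D\<close>, hence orthogonal to \<open>g\<close>; so
      \<open>w\<close> has norm zero.\<close>
    have "w \<bullet> w = (U *\<^sub>v w) \<bullet> g"
      using transpose_vec_mult_scalar[OF U w g] U w g
      by (simp add: w_def[symmetric] comm_scalar_prod[of g N])
    also have "\<dots> = 0" using orthg FU[OF w] by blast
    finally have "w = 0\<^sub>v r" using scalar_prod_self_pos[OF w] by auto
    then show "transpose_mat U *\<^sub>v g = 0\<^sub>v r" by (simp add: w_def)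
  next
    assume Ug: "transpose_mat U *\<^sub>v g = 0\<^sub>v r"
    show "(g, 0\<^sub>v N) \<in> D"
    proof (rule mem_of_orthogonal_maximally_monotone[OF D g])
      fix f e assume fe: "(f, e) \<in> D"
      define w where "w = transpose_mat U *\<^sub>v e"
      have w: "w \<in> carrier_vec r" using Ut carrier[OF fe] by (auto simp: w_def)
      \<comment> \<open>Here \<open>e = U w\<close>, and \<open>U\<close> moves to the other factor
        as its transpose, which annihilates \<open>g\<close>.\<close>
      have "e \<bullet> g = g \<bullet> (U *\<^sub>v w)"
        using range[OF fe] carrier[OF fe] g by (metis comm_scalar_prod w_def)
      also have "\<dots> = (transpose_mat U *\<^sub>v g) \<bullet> w"
        using transpose_vec_mult_scalar[OF U w g] by simp
      finally show "e \<bullet> g = 0" using Ug w by simp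
    qed
  qed
  show thesis
  proof (rule that[OF A H])
    fix v :: "real vec" assume v: "v \<in> carrier_vec N"
    define w where "w = transpose_mat U *\<^sub>v v"
    have w: "w \<in> carrier_vec r" and Fw: "F *\<^sub>v w \<in> carrier_vec N"
      using Ut F v by (auto simp: w_def)
    \<comment> \<open>Moving the outer factors of \<open>A\<close> across the scalar product turns
      the form at an arbitrary \<open>v\<close> into the pairing of \<open>(F w, U w)\<close>, an
      element of \<open>D\<close>, even when \<open>v\<close> is not a second component of
      \<open>D\<close>.\<close>
    have "v \<bullet> (A *\<^sub>v v) = w \<bullet> (transpose_mat U *\<^sub>v (F *\<^sub>v w))"
      using transpose_vec_mult_scalar[OF U _ v] Ut Fw v by (simp add: Av w_def)
    also have "\<dots> = (U *\<^sub>v w) \<bullet> (F *\<^sub>v w)"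
      using transpose_vec_mult_scalar[OF Ut Fw w] by simp
    finally show "0 \<le> v \<bullet> (A *\<^sub>v v)" using mono[OF FU[OF w]] by simp
  next
    fix f e
    show "(f, e) \<in> D \<longleftrightarrow> e \<in> carrier_vec N \<and> transpose_mat H *\<^sub>v e = 0\<^sub>v N \<and>
      (\<exists>l \<in> carrier_vec N. f = A *\<^sub>v e - H *\<^sub>v l)" (is "_ \<longleftrightarrow> ?R")
    proof
      assume fe: "(f, e) \<in> D"
      note fe' = carrier[OF fe]
      define w where "w = transpose_mat U *\<^sub>v e"
      have w: "w \<in> carrier_vec r" and Fw: "F *\<^sub>v w \<in> carrier_vec N"
        using Ut F fe' by (auto simp: w_def)
      have eq: "U *\<^sub>v w = e" using range[OF fe] by (simp add: w_def)
      \<comment> \<open>Two first components for the same \<open>e\<close> differ by some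
        \<open>g\<close> with \<open>(g, 0) \<in> D\<close>, so \<open>f\<close> and
        \<open>F w\<close> have the same image under the transpose of \<open>U\<close>.\<close>
      have "(f - F *\<^sub>v w, 0\<^sub>v N) \<in> D"
        using diff[OF fe FU[OF w]] eq fe' by simp
      then have 0: "transpose_mat U *\<^sub>v f - transpose_mat U *\<^sub>v (F *\<^sub>v w) = 0\<^sub>v r"
        using perp[of "f - F *\<^sub>v w"] Ut fe' Fw by (simp add: mult_minus_distrib_mat_vec[of _ r N])
      have "(transpose_mat U *\<^sub>v f) $ i = (transpose_mat U *\<^sub>v (F *\<^sub>v w)) $ i" if "i < r" for i
        using arg_cong[OF 0, of "\<lambda>v. v $ i"] that Ut by simp
      then have "transpose_mat U *\<^sub>v (F *\<^sub>v w) = transpose_mat U *\<^sub>v f"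
        using Ut by (intro eq_vecI) auto
      then have "A *\<^sub>v e = U *\<^sub>v (transpose_mat U *\<^sub>v f)"
        using fe' by (simp add: Av w_def)
      \<comment> \<open>The multiplier is \<open>- f\<close>: \<open>A e\<close> is the part of
        \<open>f\<close> in the range of \<open>U\<close>, and \<open>H f\<close> is the remaining
        part.\<close>
      then have "f = A *\<^sub>v e - H *\<^sub>v (- f)"
      proof -
        have "H *\<^sub>v (- f) = - (H *\<^sub>v f)"
          using fe' H by (intro eq_vecI) auto
        then show ?thesis
          using fe' U \<open>A *\<^sub>v e = _\<close> by (intro eq_vecI) (auto simp: Hv)
      qed
      moreover have "transpose_mat H *\<^sub>v e = 0\<^sub>v N"
        using fe' eq by (simp add: HtH Hv w_def)
      ultimately show ?R using fe' by (metis uminus_carrier_vec)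
    next
      assume ?R
      then obtain l where e: "e \<in> carrier_vec N" and He: "H *\<^sub>v e = 0\<^sub>v N"
        and l: "l \<in> carrier_vec N" and f: "f = A *\<^sub>v e - H *\<^sub>v l"
        by (auto simp: HtH)
      define w where "w = transpose_mat U *\<^sub>v e"
      have w: "w \<in> carrier_vec r" and Fw: "F *\<^sub>v w \<in> carrier_vec N"
        using Ut F e by (auto simp: w_def)
      have "e $ i = (U *\<^sub>v w) $ i" if "i < N" for i
        using arg_cong[OF He, of "\<lambda>v. v $ i"] that e U by (simp add: Hv w_def)
      then have eq: "e = U *\<^sub>v w" using e U by (intro eq_vecI) auto
      have f': "f \<in> carrier_vec N" using A H e l f by simp
      \<comment> \<open>The transpose of \<open>U\<close> kills \<open>H l\<close>, so
        \<open>f\<close> and \<open>F w\<close> again have the same image under it. Thus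
        \<open>(f - F w, 0) \<in> D\<close>, and adding \<open>(F w, U w)\<close> recovers
        \<open>(f, e)\<close>.\<close>
      have Ul: "transpose_mat U *\<^sub>v (H *\<^sub>v l) = 0\<^sub>v r" using UtH[OF l] .
      have "transpose_mat U *\<^sub>v f = transpose_mat U *\<^sub>v (F *\<^sub>v w)"
        unfolding f using A H e l Ut Fw Ul
        by (simp add: mult_minus_distrib_mat_vec[of _ r N] Av w_def[symmetric] UtU)
      then have "transpose_mat U *\<^sub>v (f - F *\<^sub>v w) = 0\<^sub>v r"
        using Ut Fw f' by (simp add: mult_minus_distrib_mat_vec[of _ r N])
      then have "(f - F *\<^sub>v w, 0\<^sub>v N) \<in> D" using perp f' Fw by simp
      then have "(F *\<^sub>v w + (f - F *\<^sub>v w), U *\<^sub>v w + 0\<^sub>v N) \<in> D" using FU[OF w] sub by blast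
      moreover have "F *\<^sub>v w + (f - F *\<^sub>v w) = f"
        using Fw F f' by (intro eq_vecI) auto
      ultimately show "(f, e) \<in> D" using eq e by simp
    qed
  qed
qed


section \<open>Splitting into state and port blocks\<close>

lemma append_rows_split:
  assumes "C \<in> carrier_mat (n + m) k"
  obtains G GP where "G \<in> carrier_mat n k" "GP \<in> carrier_mat m k" "C = G @\<^sub>r GP"
proof
  show "mat n k (($$) C) \<in> carrier_mat n k" "mat m k (\<lambda>(i, j). C $$ (n + i, j)) \<in> carrier_mat m k"
    by auto
  show "C = mat n k (($$) C) @\<^sub>r mat m k (\<lambda>(i, j). C $$ (n + i, j))"
    using assms by (intro eq_matI) (auto simp: append_rows_def)
qed

text \<open>Turns the kernel condition on \<open>H\<close> into the algebraic constraint on state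
  and port efforts.\<close>

lemma transpose_append_rows_mult_vec:
  fixes G GP :: "'a :: comm_semiring_1 mat"
  assumes "G \<in> carrier_mat n k" "GP \<in> carrier_mat m k" "a \<in> carrier_vec n" "b \<in> carrier_vec m"
  shows "transpose_mat (G @\<^sub>r GP) *\<^sub>v (a @\<^sub>v b) = transpose_mat G *\<^sub>v a + transpose_mat GP *\<^sub>v b"
proof (rule eq_vecI)
  fix j assume "j < dim_vec (transpose_mat G *\<^sub>v a + transpose_mat GP *\<^sub>v b)"
  then have j: "j < k" using assms by simp
  have "col (G @\<^sub>r GP) j = col G j @\<^sub>v col GP j"
    unfolding append_rows_def using assms j by (intro col_four_block_mat) auto
  then show "(transpose_mat (G @\<^sub>r GP) *\<^sub>v (a @\<^sub>v b)) $ j =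
      (transpose_mat G *\<^sub>v a + transpose_mat GP *\<^sub>v b) $ j"
    using assms j carrier_append_rows[OF assms(1,2)]
    by (simp add: scalar_prod_append[of _ n _ m] del: carrier_append_rows)
qed (use assms carrier_matD(2)[OF carrier_append_rows[OF assms(1,2)]] in auto)

text \<open>A matrix and its transpose have the same quadratic form, so averaging the two changes
  nothing.\<close>

lemma scalar_prod_symmetric_part:
  fixes A :: "real mat"
  assumes A: "A \<in> carrier_mat N N" and v: "v \<in> carrier_vec N"
  shows "v \<bullet> (((1 / 2) \<cdot>\<^sub>m (A + transpose_mat A)) *\<^sub>v v) = v \<bullet> (A *\<^sub>v v)"
proof -
  have "((1 / 2) \<cdot>\<^sub>m (A + transpose_mat A)) *\<^sub>v v = (1 / 2) \<cdot>\<^sub>v (A *\<^sub>v v + transpose_mat A *\<^sub>v v)"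
    using A v by (subst add_mult_distrib_mat_vec[symmetric, of _ N N]) (auto intro!: eq_vecI)
  moreover have "v \<bullet> (transpose_mat A *\<^sub>v v) = v \<bullet> (A *\<^sub>v v)"
    using transpose_vec_mult_scalar[OF A v v] A v
    by (metis comm_scalar_prod mult_mat_vec_carrier transpose_carrier_mat)
  ultimately show ?thesis
    using A v by (simp add: scalar_prod_add_distrib[of _ N])
qed

lemma pos_semidef_symmetric_part:
  fixes A :: "real mat"
  assumes A: "A \<in> carrier_mat N N" and "\<And>v. v \<in> carrier_vec N \<Longrightarrow> 0 \<le> v \<bullet> (A *\<^sub>v v)"
  shows "pos_semidef_mat ((1 / 2) \<cdot>\<^sub>m (A + transpose_mat A))"
  using assms scalar_prod_symmetric_part[OF A]
  by (auto simp: pos_semidef_mat_def intro!: eq_matI)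

text \<open>The symmetric part of \<open>A\<close> has the blocks \<open>R\<close>,
  \<open>V\<close>, \<open>W\<close>, and the skew part has the blocks \<open>- J\<close>,
  \<open>- B\<close>, the transpose of \<open>B\<close>, and \<open>N\<close>. The minus signs in
  the first block row anticipate that the state flow in \<open>M\<close> is the negative of
  \<open>P *\<^sub>v zdot\<close>.\<close>

lemma port_block_decomposition:
  fixes A :: "real mat"
  assumes A: "A \<in> carrier_mat (n + m) (n + m)"
    and pos: "\<And>v. v \<in> carrier_vec (n + m) \<Longrightarrow> 0 \<le> v \<bullet> (A *\<^sub>v v)"
  obtains J R N W B V where
    "J \<in> carrier_mat n n" "R \<in> carrier_mat n n" "N \<in> carrier_mat m m" "W \<in> carrier_mat m m"
    "B \<in> carrier_mat n m" "V \<in> carrier_mat n m" "skew_symmetric_mat J" "skew_symmetric_mat N"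
    "pos_semidef_mat (four_block_mat R V (transpose_mat V) W)"
    "A = four_block_mat (- (J - R)) (- (B - V)) (transpose_mat (B + V)) (N + W)"
proof -
  obtain A1 A2 A3 A4 where split: "split_block A n n = (A1, A2, A3, A4)"
    by (metis prod_cases4)
  have A1: "A1 \<in> carrier_mat n n" and A2: "A2 \<in> carrier_mat n m"
    and A3: "A3 \<in> carrier_mat m n" and A4: "A4 \<in> carrier_mat m m"
    and A_eq: "A = four_block_mat A1 A2 A3 A4"
    using split_block[OF split, of m m] A by auto
  note dims = A1 A2 A3 A4
  define J where "J = (1 / 2) \<cdot>\<^sub>m (transpose_mat A1 - A1)"
  define R where "R = (1 / 2) \<cdot>\<^sub>m (A1 + transpose_mat A1)"
  define N where "N = (1 / 2) \<cdot>\<^sub>m (A4 - transpose_mat A4)"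
  define W where "W = (1 / 2) \<cdot>\<^sub>m (A4 + transpose_mat A4)"
  define B where "B = (1 / 2) \<cdot>\<^sub>m (transpose_mat A3 - A2)"
  define V where "V = (1 / 2) \<cdot>\<^sub>m (A2 + transpose_mat A3)"
  note defs = J_def R_def N_def W_def B_def V_def
  show thesis
  proof (rule that)
    show "J \<in> carrier_mat n n" "R \<in> carrier_mat n n" "N \<in> carrier_mat m m" "W \<in> carrier_mat m m"
      "B \<in> carrier_mat n m" "V \<in> carrier_mat n m"
      using dims by (auto simp: defs)
    show "skew_symmetric_mat J" "skew_symmetric_mat N"
      using dims by (auto simp: skew_symmetric_mat_def defs diff_divide_distrib intro!: eq_matI)
    have "four_block_mat R V (transpose_mat V) W = (1 / 2) \<cdot>\<^sub>m (A + transpose_mat A)"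
      unfolding A_eq using dims by (intro eq_matI) (auto simp: defs)
    then show "pos_semidef_mat (four_block_mat R V (transpose_mat V) W)"
      using pos_semidef_symmetric_part[OF A pos] by simp
    have "A1 = - (J - R)" "A2 = - (B - V)" "A3 = transpose_mat (B + V)" "A4 = N + W"
      using dims by (auto simp: defs diff_divide_distrib add_divide_distrib intro!: eq_matI)
    then show "A = four_block_mat (- (J - R)) (- (B - V)) (transpose_mat (B + V)) (N + W)"
      by (simp add: A_eq)
  qed
qed

text \<open>A concatenation determines both of its pieces once the length of the first is known, and
  here that length is \<open>n\<close> on both sides.\<close>

lemma port_identification_mem_iff:
  assumes "M \<subseteq> carrier_vec n \<times> carrier_vec n \<times> carrier_vec m \<times> carrier_vec m"
    and "f \<in> carrier_vec n" "e \<in> carrier_vec n"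
  shows "(f, e, fP, eP) \<in> M \<longleftrightarrow> (f @\<^sub>v fP, e @\<^sub>v eP) \<in> port_identification ` M"
proof
  assume "(f @\<^sub>v fP, e @\<^sub>v eP) \<in> port_identification ` M"
  then obtain f' e' fP' eP' where *: "(f', e', fP', eP') \<in> M"
    "f @\<^sub>v fP = f' @\<^sub>v fP'" "e @\<^sub>v eP = e' @\<^sub>v eP'"
    by (auto simp: port_identification_def)
  then have "f' \<in> carrier_vec n" "e' \<in> carrier_vec n" using assms(1) by auto
  then show "(f, e, fP, eP) \<in> M"
    using * append_vec_eq[OF assms(2), of f'] append_vec_eq[OF assms(3), of e'] by simp
qed (force simp: port_identification_def)


lemma minus_append_vec:
  fixes a :: "'a :: group_add vec"
  assumes "a \<in> carrier_vec n" "c \<in> carrier_vec n" "b \<in> carrier_vec m" "d \<in> carrier_vec m"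
  shows "(a @\<^sub>v b) - (c @\<^sub>v d) = (a - c) @\<^sub>v (b - d)"
  using assms by (intro eq_vecI) auto

section \<open>The equations of the port-Hamiltonian system\<close>

theorem mainTheorem3:
  fixes n m :: nat
    and M :: "(real vec \<times> real vec \<times> real vec \<times> real vec) set"
    and L :: "(real vec \<times> real vec) set"
    and P S :: "real mat"
  assumes M: "maximally_monotone_port_structure n m M"
    and P: "P \<in> carrier_mat n n"
    and S: "S \<in> carrier_mat n n"
    and L: "lagrange_structure n L"
    and L_image: "L = stacked_image P S"
    and sym: "transpose_mat S * P = transpose_mat P * S"
    and rank: "vec_space.rank (n + n) (P @\<^sub>r S) = n"
  shows "\<exists>k J R N W B V G GP.
    J \<in> carrier_mat n n \<and> R \<in> carrier_mat n n \<and>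
    N \<in> carrier_mat m m \<and> W \<in> carrier_mat m m \<and>
    B \<in> carrier_mat n m \<and> V \<in> carrier_mat n m \<and>
    G \<in> carrier_mat n k \<and> GP \<in> carrier_mat m k \<and>
    skew_symmetric_mat J \<and> skew_symmetric_mat N \<and>
    pos_semidef_mat (four_block_mat R V (transpose_mat V) W) \<and>
    (\<forall>zdot \<in> carrier_vec n. \<forall>x fP eP.
      (P *\<^sub>v zdot, x, fP, eP) \<in> pH_DAE_system M L \<longleftrightarrow>
      eP \<in> carrier_vec m \<and>
      (\<exists>z \<in> carrier_vec n. x = P *\<^sub>v z \<and>
        (\<exists>l \<in> carrier_vec k. pH_DAE_equations P S J R N W B V G GP zdot z fP eP l))) \<and>
    (\<forall>I z zdot fP eP.
      nondegenerate_interval I \<and> has_vec_derivative_on n z zdot I \<and>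
      (\<forall>t \<in> I. fP t \<in> carrier_vec m \<and> eP t \<in> carrier_vec m) \<longrightarrow>
      ((\<forall>t \<in> I. (- (P *\<^sub>v zdot t), S *\<^sub>v z t, fP t, eP t) \<in> M) \<longleftrightarrow>
       (\<exists>l. \<forall>t \<in> I. l t \<in> carrier_vec k \<and>
          pH_DAE_equations P S J R N W B V G GP (zdot t) (z t) (fP t) (eP t) (l t))))"
proof -
  define D where "D = port_identification ` M"
  have sub: "M \<subseteq> carrier_vec n \<times> carrier_vec n \<times> carrier_vec m \<times> carrier_vec m"
    and D: "maximally_monotone_structure (n + m) D"
    using M by (auto simp: maximally_monotone_port_structure_def D_def)
  obtain A H where A: "A \<in> carrier_mat (n + m) (n + m)" and H: "H \<in> carrier_mat (n + m) (n + m)"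
    and pos: "\<And>v. v \<in> carrier_vec (n + m) \<Longrightarrow> 0 \<le> v \<bullet> (A *\<^sub>v v)"
    and D_iff: "\<And>f e. (f, e) \<in> D \<longleftrightarrow> e \<in> carrier_vec (n + m) \<and>
      transpose_mat H *\<^sub>v e = 0\<^sub>v (n + m) \<and> (\<exists>l \<in> carrier_vec (n + m). f = A *\<^sub>v e - H *\<^sub>v l)"
    using maximally_monotone_structure_representation[OF D] by metis
  \<comment> \<open>\<open>H\<close> is square, so the multiplier has \<open>n + m\<close> entries;
    some \<open>k\<close> is asked for, not a smallest one.\<close>
  define k where "k = n + m"
  obtain G GP where G: "G \<in> carrier_mat n k" and GP: "GP \<in> carrier_mat m k" and H_eq: "H = G @\<^sub>r GP"
    using append_rows_split[OF H] by (metis k_def)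
  obtain J R N W B V where J: "J \<in> carrier_mat n n" and R: "R \<in> carrier_mat n n"
    and N: "N \<in> carrier_mat m m" and W: "W \<in> carrier_mat m m"
    and B: "B \<in> carrier_mat n m" and V: "V \<in> carrier_mat n m"
    and skew: "skew_symmetric_mat J" "skew_symmetric_mat N"
    and psd: "pos_semidef_mat (four_block_mat R V (transpose_mat V) W)"
    and A_eq: "A = four_block_mat (- (J - R)) (- (B - V)) (transpose_mat (B + V)) (N + W)"
    using port_block_decomposition[OF A pos] by metis
  have blocks: "J - R \<in> carrier_mat n n" "B - V \<in> carrier_mat n m"
    "transpose_mat (B + V) \<in> carrier_mat m n" "N + W \<in> carrier_mat m m"
    using J R N W B V by auto
  \<comment> \<open>A pointwise statement in which \<open>zdot\<close> is an arbitrary vector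
    unrelated to \<open>z\<close>. Both equivalences of the theorem reduce to it.\<close>
  have equations_iff: "(- (P *\<^sub>v zdot), S *\<^sub>v z, fP, eP) \<in> M \<longleftrightarrow>
      (\<exists>l \<in> carrier_vec k. pH_DAE_equations P S J R N W B V G GP zdot z fP eP l)"
    if zdot: "zdot \<in> carrier_vec n" and z: "z \<in> carrier_vec n" and eP: "eP \<in> carrier_vec m"
    for zdot z fP eP
  proof -
    define p where "p = P *\<^sub>v zdot"
    define s where "s = S *\<^sub>v z"
    have p: "p \<in> carrier_vec n" and s: "s \<in> carrier_vec n"
      using P S zdot z by (simp_all add: p_def s_def)
    define X where "X = (J - R) *\<^sub>v s"
    define X' where "X' = (B - V) *\<^sub>v eP"
    define Y where "Y = transpose_mat (B + V) *\<^sub>v s + (N + W) *\<^sub>v eP"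
    have X: "X \<in> carrier_vec n" and X': "X' \<in> carrier_vec n" and Y: "Y \<in> carrier_vec m"
      unfolding X_def X'_def Y_def using blocks s eP by (auto intro!: mult_mat_vec_carrier)
    have "A *\<^sub>v (s @\<^sub>v eP) = (- X + - X') @\<^sub>v Y"
      unfolding A_eq X_def X'_def Y_def
      using blocks R V s eP by (subst four_block_mat_mult_vec[of _ n n _ m _ m]) auto
    moreover have "H *\<^sub>v l = (G *\<^sub>v l) @\<^sub>v (GP *\<^sub>v l)" if "l \<in> carrier_vec k" for l
      unfolding H_eq using G GP that by (rule mat_mult_append)
    ultimately have AH: "A *\<^sub>v (s @\<^sub>v eP) - H *\<^sub>v l = (- X + - X' - G *\<^sub>v l) @\<^sub>v (Y - GP *\<^sub>v l)"
      if "l \<in> carrier_vec k" for l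
      using X X' Y G GP that by (simp add: minus_append_vec[of _ n _ _ m])
    \<comment> \<open>Negating the state row of the representation of \<open>D\<close> gives the
      differential equation; the port row keeps its sign.\<close>
    have flow: "- p = - X + - X' - G *\<^sub>v l \<longleftrightarrow> p = X + G *\<^sub>v l + X'" if "l \<in> carrier_vec k" for l
    proof -
      have "G *\<^sub>v l \<in> carrier_vec n" using G that by simp
      then have "- (X + G *\<^sub>v l + X') = - X + - X' - G *\<^sub>v l"
        using X X' G by (intro eq_vecI) auto
      then show ?thesis by (metis uminus_uminus_vec)
    qed
    have "(- p, s, fP, eP) \<in> M \<longleftrightarrow> (- p @\<^sub>v fP, s @\<^sub>v eP) \<in> D"
      unfolding D_def using sub p s by (intro port_identification_mem_iff) auto
    also have "\<dots> \<longleftrightarrow> transpose_mat G *\<^sub>v s + transpose_mat GP *\<^sub>v eP = 0\<^sub>v k \<and>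
        (\<exists>l \<in> carrier_vec k. - p @\<^sub>v fP = (- X + - X' - G *\<^sub>v l) @\<^sub>v (Y - GP *\<^sub>v l))"
      unfolding D_iff using s eP AH
      by (simp add: H_eq transpose_append_rows_mult_vec[OF G GP s eP] k_def[symmetric] cong: bex_cong)
        (simp add: k_def)
    also have "\<dots> \<longleftrightarrow> 0\<^sub>v k = transpose_mat G *\<^sub>v s + transpose_mat GP *\<^sub>v eP \<and>
        (\<exists>l \<in> carrier_vec k. p = X + G *\<^sub>v l + X' \<and> fP = Y - GP *\<^sub>v l)"
      using p X X' G flow by (auto simp: append_vec_eq[of _ n])
    finally show ?thesis
      using G by (auto simp: pH_DAE_equations_def p_def s_def X_def X'_def Y_def)
  qed
  have system_iff: "(P *\<^sub>v zdot, x, fP, eP) \<in> pH_DAE_system M L \<longleftrightarrow>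
      eP \<in> carrier_vec m \<and> (\<exists>z \<in> carrier_vec n. x = P *\<^sub>v z \<and>
        (\<exists>l \<in> carrier_vec k. pH_DAE_equations P S J R N W B V G GP zdot z fP eP l))"
    if zdot: "zdot \<in> carrier_vec n" for zdot x fP eP
  proof -
    \<comment> \<open>The hidden effort \<open>e\<close> is eliminated through the image form of
      \<open>L\<close>: one and the same \<open>z\<close> produces \<open>x = P z\<close> and
      \<open>e = S z\<close>.\<close>
    have "(P *\<^sub>v zdot, x, fP, eP) \<in> pH_DAE_system M L \<longleftrightarrow>
        (\<exists>z \<in> carrier_vec n. x = P *\<^sub>v z \<and> (- (P *\<^sub>v zdot), S *\<^sub>v z, fP, eP) \<in> M)"
      using P by (auto simp: pH_DAE_system_def L_image stacked_image_def)
    then show ?thesis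
      using sub equations_iff[OF zdot] by blast
  qed
  have trajectory_iff: "(\<forall>t \<in> I. (- (P *\<^sub>v zdot t), S *\<^sub>v z t, fP t, eP t) \<in> M) \<longleftrightarrow>
      (\<exists>l. \<forall>t \<in> I. l t \<in> carrier_vec k \<and>
        pH_DAE_equations P S J R N W B V G GP (zdot t) (z t) (fP t) (eP t) (l t))"
    if "has_vec_derivative_on n z zdot I" "\<forall>t \<in> I. eP t \<in> carrier_vec m" for I z zdot fP eP
  proof -
    have "(- (P *\<^sub>v zdot t), S *\<^sub>v z t, fP t, eP t) \<in> M \<longleftrightarrow>
        (\<exists>l. l \<in> carrier_vec k \<and>
          pH_DAE_equations P S J R N W B V G GP (zdot t) (z t) (fP t) (eP t) l)" if "t \<in> I" for t
      using equations_iff[of "zdot t" "z t" "eP t" "fP t"] that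
        \<open>has_vec_derivative_on n z zdot I\<close> \<open>\<forall>t \<in> I. eP t \<in> carrier_vec m\<close>
      by (auto simp: has_vec_derivative_on_def)
    \<comment> \<open>The multiplier is chosen separately at each time; no regularity in
      \<open>t\<close> is asked of it.\<close>
    then show ?thesis by (simp add: bchoice_iff)
  qed
  show ?thesis
    by (rule exI[of _ k], rule exI[of _ J], rule exI[of _ R], rule exI[of _ N], rule exI[of _ W],
        rule exI[of _ B], rule exI[of _ V], rule exI[of _ G], rule exI[of _ GP], intro conjI)
      (use J R N W B V G GP skew psd system_iff trajectory_iff in simp_all)
qed

end
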